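(* Let $p$ be a prime and let $S$ be a $p$-divisible multiset on $\mathbb{F}_p^3$ over $\mathbb{F}_p$, with weight function $f_S:\mathbb{F}_p^3\to\mathbb{F}_p$; that is, $\sum_{x\in H} f_S(x)=0$ in $\mathbb{F}_p$ for every affine plane $H\subseteq\mathbb{F}_p^3$. Then $f_S$ lies in each of the following $\mathbb{F}_p$-linear subspaces of the space of functions $\mathbb{F}_p^3\to\mathbb{F}_p$: 1. the $\mathbb{F}_p$-linear span of (the characteristic functions of) cylinders; 2. the $\mathbb{F}_p$-linear span of (the weight functions of) cylinder type multisets; 3. the $\mathbb{F}_p$-linear span of differences of parallel lines, i.e. $\operatorname{Span}_{\mathbb{F}_p}\{\mathbf{1}_{\ell_1}-\mathbf{1}_{\ell_2} : \ell_1,\ell_2 \text{ affine lines in } \mathbb{F}_p^3,\ \ell_1\parallel \ell_2\}$.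
   Context: Lines and planes are affine one- and two-dimensional subspaces of $\mathbb{F}_p^3$. For a subset $X\subseteq\mathbb{F}_p^3$, $\mathbf{1}_X$ denotes its characteristic function, here regarded as $\mathbb{F}_p$-valued. Write $\ell_1\parallel\ell_2$ if the lines $\ell_1,\ell_2$ are parallel. A cylinder is a subset of $\mathbb{F}_p^3$ that is the union of $p$ pairwise disjoint parallel lines (so it has $p^2$ points). A cylinder type multiset is one whose weight function is a sum $\mathbf{1}_{\ell_1}+\dots+\mathbf{1}_{\ell_p}$ of characteristic functions of $p$ pairwise parallel, not necessarily distinct, affine lines (here taken with values in $\mathbb{F}_p$). A multiset over $\mathbb{F}_p$ is identified with its weight function $\mathbb{F}_p^3\to\mathbb{F}_p$. *)

theory Defs
  imports "HOL-Analysis.Cartesian_Space" "HOL-Library.Function_Algebras"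
    "HOL-Library.Indicator_Function" "HOL-Computational_Algebra.Primes"
begin

text \<open>The prime field with \<open>p\<close> elements is rendered as a finite field type \<open>'a\<close> with
  \<open>CARD('a) = p\<close> prime; in the definitions below, \<open>CARD('a)\<close> plays the role of \<open>p\<close>.\<close>

definition affine_subspace_dim :: "nat \<Rightarrow> ('a::field ^ 'n) set \<Rightarrow> bool" where
  "affine_subspace_dim k X \<longleftrightarrow>
     (\<exists>a V. vec.subspace V \<and> vec.dim V = k \<and> X = (\<lambda>v. a + v) ` V)"

definition affine_line :: "('a::field ^ 3) set \<Rightarrow> bool" where
  "affine_line l \<longleftrightarrow> affine_subspace_dim 1 l"

definition affine_plane :: "('a::field ^ 3) set \<Rightarrow> bool" where
  "affine_plane H \<longleftrightarrow> affine_subspace_dim 2 H"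

text \<open>Two lines are parallel iff they are translates of each other; in particular, every line is
  parallel to itself.\<close>

definition parallel_lines :: "('a::field ^ 3) set \<Rightarrow> ('a ^ 3) set \<Rightarrow> bool" where
  "parallel_lines l1 l2 \<longleftrightarrow>
     affine_line l1 \<and> affine_line l2 \<and> (\<exists>a. l2 = (\<lambda>x. a + x) ` l1)"

definition cylinder :: "('a::{field,finite} ^ 3) set \<Rightarrow> bool" where
  "cylinder X \<longleftrightarrow>
     (\<exists>L. card L = CARD('a) \<and> (\<forall>l\<in>L. affine_line l) \<and>
          (\<forall>l\<in>L. \<forall>m\<in>L. parallel_lines l m) \<and>
          (\<forall>l\<in>L. \<forall>m\<in>L. l \<noteq> m \<longrightarrow> l \<inter> m = {}) \<and>
          X = \<Union>L)"

text \<open>Multisets over the field are identified with their weight functions. The lines of a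
  cylinder type multiset are given as an indexed family, since repetitions are allowed.\<close>

definition cylinder_type_multiset :: "('a::{field,finite} ^ 3 \<Rightarrow> 'a) \<Rightarrow> bool" where
  "cylinder_type_multiset f \<longleftrightarrow>
     (\<exists>l :: nat \<Rightarrow> ('a ^ 3) set.
          (\<forall>i<CARD('a). affine_line (l i)) \<and>
          (\<forall>i<CARD('a). \<forall>j<CARD('a). parallel_lines (l i) (l j)) \<and>
          f = (\<lambda>x. \<Sum>i<CARD('a). indicator (l i) x))"

definition p_divisible :: "('a::{field,finite} ^ 3 \<Rightarrow> 'a) \<Rightarrow> bool" where
  "p_divisible f \<longleftrightarrow> (\<forall>H. affine_plane H \<longrightarrow> (\<Sum>x\<in>H. f x) = 0)"

definition fun_scale :: "'a::field \<Rightarrow> ('b \<Rightarrow> 'a) \<Rightarrow> ('b \<Rightarrow> 'a)" where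
  "fun_scale c f = (\<lambda>x. c * f x)"

global_interpretation fun_space: vector_space "fun_scale :: 'a::field \<Rightarrow> ('b \<Rightarrow> 'a) \<Rightarrow> ('b \<Rightarrow> 'a)"
  by unfold_locales (auto simp: fun_scale_def fun_eq_iff algebra_simps)

end

theory Submission
  imports Defs "HOL-Computational_Algebra.Polynomial"
begin

text \<open>
  Summing \<open>f(x) (x\<^sub>1 + s x\<^sub>2 + t x\<^sub>3)^m\<close> plane by plane gives \<open>0\<close>, and comparing coefficients
  in \<open>s\<close> and \<open>t\<close> shows that all moments of \<open>f\<close> of degree at most \<open>p - 1\<close> vanish. By interpolation,
  \<open>f\<close> is therefore a combination of monomials of degree at most \<open>2p - 3\<close> with all exponents
  at most \<open>p - 1\<close>. On the other hand, for \<open>a, b \<le> p - 1\<close> with \<open>a + b \<le> 2p - 3\<close> the function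
  \<open>(x\<^sub>1 + s x\<^sub>3)^a (x\<^sub>2 + t x\<^sub>3)^b\<close> is constant on the lines of one parallel class, and its values on
  these lines sum to \<open>0\<close>; hence it is a combination of differences of parallel lines. Again
  comparing coefficients in \<open>s\<close> and \<open>t\<close>, which involve only binomial coefficients that are nonzero
  modulo \<open>p\<close>, yields every one of those monomials.
  Finally, a difference of parallel lines is a difference of two cylinders, and it is itself
  a cylinder type multiset because \<open>-1 = p - 1\<close> in the field.
\<close>

section \<open>Power sums and interpolation over a finite field\<close>

text \<open>Translation by 1 permutes the field, so it leaves the sum of all elements
  unchanged.\<close>

lemma of_nat_CARD_eq_0: "of_nat CARD('a) = (0 :: 'a::{field,finite})"
proof -
  have "(\<Sum>x\<in>UNIV. x + 1) = (\<Sum>x\<in>UNIV. x :: 'a)"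
    by (rule sum.reindex_bij_witness[of _ "\<lambda>x. x - 1" "\<lambda>x. x + 1"]) auto
  then show ?thesis by (simp add: sum.distrib)
qed

lemma of_nat_neq_0_of_coprime_CARD:
  assumes "coprime n CARD('a)"
  shows "of_nat n \<noteq> (0 :: 'a::{field,finite})"
proof
  assume "of_nat n = (0 :: 'a)"
  then have "CHAR('a) dvd n" "CHAR('a) dvd CARD('a)"
    using of_nat_CARD_eq_0[where 'a='a] by (simp_all add: of_nat_eq_0_iff_char_dvd)
  then have "CHAR('a) dvd 1" using assms by (metis coprime_common_divisor)
  then show False by simp
qed

text \<open>The binomial coefficient divides \<open>fact n\<close>, which is prime to
  \<open>CARD('a)\<close> because \<open>n < CARD('a)\<close>. This allows binomial factors to be
  cancelled below.\<close>

lemma of_nat_binomial_neq_0: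
  assumes "prime CARD('a)" "n < CARD('a)" "k \<le> n"
  shows "of_nat (n choose k) \<noteq> (0 :: 'a::{field,finite})"
proof (rule of_nat_neq_0_of_coprime_CARD)
  have "\<not> CARD('a) dvd fact n"
    using assms by (simp add: prime_dvd_fact_iff)
  moreover have "(n choose k) dvd fact n"
    using binomial_fact_lemma[OF assms(3)] by (metis dvd_triv_right)
  ultimately have "\<not> CARD('a) dvd (n choose k)" using dvd_trans by blast
  then show "coprime (n choose k) CARD('a)"
    using assms(1) by (metis coprime_commute prime_imp_coprime)
qed

text \<open>Multiplication by a nonzero \<open>x\<close> permutes the nonzero elements; comparing
  their product before and after gives Fermat's identity.\<close>

lemma power_CARD_eq_same: "x ^ CARD('a) = (x :: 'a::{field,finite})"
proof (cases "x = 0")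
  case False
  have "prod ((*) x) (UNIV - {0}) = (\<Prod>y\<in>UNIV - {0}. y)"
    by (rule prod.reindex_bij_witness[of _ "\<lambda>y. y / x" "\<lambda>y. x * y"]) (use False in auto)
  then have "x ^ (CARD('a) - 1) * (\<Prod>y\<in>UNIV - {0 :: 'a}. y) = (\<Prod>y\<in>UNIV - {0}. y)"
    by (simp add: prod.distrib)
  then have "x ^ (CARD('a) - 1) = 1" by simp
  then show ?thesis
    by (metis finite_UNIV_card_ge_0 finite mult.right_neutral power_minus_mult mult_1)
qed simp

text \<open>For \<open>i < p = CARD('a)\<close>, this is the coefficient of \<open>x ^ i\<close> in
  \<open>1 - (x - y) ^ (p - 1)\<close>, the indicator of \<open>x = y\<close> as a polynomial in \<open>x\<close>.\<close>

definition interpol :: "nat \<Rightarrow> 'a::{field,finite} \<Rightarrow> 'a" where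
  "interpol i y = of_bool (i = 0) - y ^ (CARD('a) - 1 - i)"

lemma sum_interpol:
  fixes x y :: "'a::{field,finite}"
  shows "(\<Sum>i<CARD('a). x ^ i * interpol i y) = of_bool (x = y)"
proof -
  let ?p = "CARD('a)"
  have p: "?p > 0" by (simp add: finite_UNIV_card_ge_0)
  let ?S = "\<Sum>i<?p. x ^ i * y ^ (?p - 1 - i)"
  have "(\<Sum>i<?p. x ^ i * interpol i y) = (\<Sum>i<?p. x ^ i * of_bool (i = 0)) - ?S"
    by (simp add: interpol_def right_diff_distrib sum_subtractf)
  also have "(\<Sum>i<?p. x ^ i * of_bool (i = 0)) = (\<Sum>i\<in>{0}. x ^ i * of_bool (i = 0))"
    by (rule sum.mono_neutral_right) (use p in auto)
  finally have eq: "(\<Sum>i<?p. x ^ i * interpol i y) = 1 - ?S" by simp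
  show ?thesis
  proof (cases "x = y")
    case True
    have "?S = (\<Sum>i<?p. y ^ (?p - 1))"
      using True by (intro sum.cong) (auto simp flip: power_add)
    then show ?thesis using True eq of_nat_CARD_eq_0[where 'a='a] by simp
  next
    case False
    \<comment> \<open>The product telescopes to \<open>x ^ CARD('a) - y ^ CARD('a)\<close>.\<close>
    have "(x - y) * ?S = x - y"
      using diff_power_eq_sum[of x "?p - 1" y] p by (simp add: power_CARD_eq_same)
    then have "?S = 1" using False by simp
    then show ?thesis using False eq by simp
  qed
qed

lemma polynomial_function_unique:
  fixes c d :: "nat \<Rightarrow> 'a::{field,finite}"
  assumes "\<And>s. (\<Sum>i<CARD('a). c i * s ^ i) = (\<Sum>i<CARD('a). d i * s ^ i)" and "i < CARD('a)"
  shows "c i = d i"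
proof -
  let ?p = "CARD('a)"
  define P where "P c = (\<Sum>i<?p. monom (c i) i)" for c :: "nat \<Rightarrow> 'a"
  have p: "?p > 0" by (simp add: finite_UNIV_card_ge_0)
  have deg: "degree (P c) < ?p" for c
  proof -
    have "degree (P c) \<le> ?p - 1"
      unfolding P_def
      by (rule degree_sum_le) (auto intro!: order.trans[OF degree_monom_le])
    then show ?thesis using p by linarith
  qed
  have co: "coeff (P c) i = c i" for c
    using assms(2) by (simp add: P_def coeff_sum)
  have "P c = P d"
    by (rule poly_eqI_degree[of UNIV])
       (use assms(1) deg in \<open>auto simp: P_def poly_sum poly_monom\<close>)
  then show ?thesis using co by metis
qed

text \<open>The matrices \<open>x ^ i\<close> and \<open>interpol i y\<close> are inverse to each
  other; \<open>sum_interpol\<close> is their product in one order, this is the other.\<close>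

lemma sum_power_interpol:
  assumes "i < CARD('a)" "j < CARD('a)"
  shows "(\<Sum>s\<in>UNIV. s ^ j * interpol i (s :: 'a::{field,finite})) = of_bool (i = j)"
proof (rule polynomial_function_unique[OF _ assms(1),
      of "\<lambda>i. \<Sum>s\<in>UNIV. s ^ j * interpol i s" "\<lambda>i. of_bool (i = j)"])
  fix t :: 'a
  have "(\<Sum>i<CARD('a). (\<Sum>s\<in>UNIV. s ^ j * interpol i s) * t ^ i)
      = (\<Sum>s\<in>UNIV. s ^ j * (\<Sum>i<CARD('a). t ^ i * interpol i s))"
    by (simp only: sum_distrib_left sum_distrib_right, subst sum.swap) (simp add: mult_ac)
  also have "\<dots> = (\<Sum>s\<in>UNIV. if s = t then s ^ j else 0)"
    by (intro sum.cong) (auto simp: sum_interpol)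
  also have "\<dots> = t ^ j" by simp
  also have "\<dots> = (\<Sum>i<CARD('a). if i = j then t ^ i else 0)" using assms(2) by simp
  also have "\<dots> = (\<Sum>i<CARD('a). of_bool (i = j) * t ^ i)" by (intro sum.cong) auto
  finally show "(\<Sum>i<CARD('a). (\<Sum>s\<in>UNIV. s ^ j * interpol i s) * t ^ i)
      = (\<Sum>i<CARD('a). of_bool (i = j) * t ^ i)" .
qed

lemma sum_power_eq_0:
  assumes "j < CARD('a) - 1"
  shows "(\<Sum>s\<in>UNIV. s ^ j :: 'a::{field,finite}) = 0"
proof -
  \<comment> \<open>Hence the power sum is, up to sign, the coefficient of degree
    \<open>CARD('a) - 1\<close> in \<open>s ^ j\<close>.\<close>
  have "interpol (CARD('a) - 1) s = -1" for s :: 'a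
    using assms by (simp add: interpol_def)
  then show ?thesis
    using sum_power_interpol[of "CARD('a) - 1" j, where 'a='a] assms by (simp add: sum_negf)
qed

section \<open>Extracting coefficients in a subspace of functions\<close>

lemma fun_subspace_scale:
  "fun_space.subspace D \<Longrightarrow> g \<in> D \<Longrightarrow> (\<lambda>x. c * g x) \<in> D"
  using fun_space.subspace_scale[of D g c] by (simp add: fun_scale_def)

lemma fun_subspace_sum:
  assumes "fun_space.subspace D" "\<And>i. i \<in> I \<Longrightarrow> (\<lambda>x. g i x) \<in> D"
  shows "(\<lambda>x. \<Sum>i\<in>I. g i x) \<in> D"
proof -
  have "(\<lambda>x. \<Sum>i\<in>I. g i x) = (\<Sum>i\<in>I. g i)"
    by (induction I rule: infinite_finite_induct) (auto simp: fun_eq_iff)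
  then show ?thesis using fun_space.subspace_sum[OF assms(1), of I g] assms(2) by simp
qed

lemma fun_subspace_diff:
  "fun_space.subspace D \<Longrightarrow> g \<in> D \<Longrightarrow> h \<in> D \<Longrightarrow> (\<lambda>x. g x - h x) \<in> D"
  using fun_space.subspace_diff[of D g h] by (simp add: fun_diff_def)

text \<open>The weights \<open>interpol r s\<close> invert the Vandermonde system, so
  \<open>w r\<close> is a linear combination of the given members.\<close>

lemma coefficient_mem_subspace:
  fixes w :: "nat \<Rightarrow> 'b \<Rightarrow> 'a::{field,finite}"
  assumes D: "fun_space.subspace D"
    and mem: "\<And>s. (\<lambda>x. \<Sum>r\<le>n. s ^ r * w r x) \<in> D"
    and n: "n < CARD('a)" and r: "r \<le> n"
  shows "w r \<in> D"
proof -
  have "w r x = (\<Sum>s\<in>UNIV. interpol r s * (\<Sum>j\<le>n. s ^ j * w j x))" for x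
  proof -
    have "(\<Sum>s\<in>UNIV. interpol r s * (\<Sum>j\<le>n. s ^ j * w j x))
        = (\<Sum>j\<le>n. (\<Sum>s\<in>UNIV. s ^ j * interpol r s) * w j x)"
      by (simp only: sum_distrib_left sum_distrib_right, subst sum.swap) (simp add: mult_ac)
    also have "\<dots> = (\<Sum>j\<le>n. if j = r then w j x else 0)"
      using n r by (intro sum.cong) (auto simp: sum_power_interpol)
    finally show ?thesis using r by simp
  qed
  then have eq: "w r = (\<lambda>x. \<Sum>s\<in>UNIV. interpol r s * (\<Sum>j\<le>n. s ^ j * w j x))"
    by blast
  show ?thesis
    by (subst eq) (rule fun_subspace_sum[OF D fun_subspace_scale[OF D mem]])
qed

text \<open>Expand in powers of \<open>s\<close>, isolate the coefficient of \<open>s ^ r\<close>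
  and cancel its binomial factor. Below, \<open>D\<close> is either the functions orthogonal to
  \<open>f\<close> or the span of line differences.\<close>

lemma binomial_term_mem_subspace:
  fixes g u v :: "'b \<Rightarrow> 'a::{field,finite}"
  assumes p: "prime CARD('a)" and D: "fun_space.subspace D"
    and mem: "\<And>s. (\<lambda>x. g x * (u x + s * v x) ^ n) \<in> D"
    and n: "n < CARD('a)" and r: "r \<le> n"
  shows "(\<lambda>x. g x * (u x ^ (n - r) * v x ^ r)) \<in> D"
proof -
  let ?c = "of_nat (n choose r) :: 'a"
  have eq: "(\<lambda>x. g x * (u x + s * v x) ^ n)
      = (\<lambda>x. \<Sum>r\<le>n. s ^ r * (of_nat (n choose r) * (g x * (u x ^ (n - r) * v x ^ r))))" for s
  proof
    fix x
    show "g x * (u x + s * v x) ^ n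
      = (\<Sum>r\<le>n. s ^ r * (of_nat (n choose r) * (g x * (u x ^ (n - r) * v x ^ r))))"
      using binomial_ring[of "s * v x" "u x" n]
      by (simp add: add.commute sum_distrib_left power_mult_distrib mult_ac)
  qed
  have "(\<lambda>x. ?c * (g x * (u x ^ (n - r) * v x ^ r))) \<in> D"
    using coefficient_mem_subspace[OF D _ n r,
        of "\<lambda>r x. of_nat (n choose r) * (g x * (u x ^ (n - r) * v x ^ r))"] mem
    unfolding eq by blast
  from fun_subspace_scale[OF D this, of "inverse ?c"] show ?thesis
    using of_nat_binomial_neq_0[OF p n r] by (simp add: mult.assoc[symmetric])
qed

text \<open>The constant 1 occurs in \<open>interpol i\<close> for \<open>i = 0\<close> alone, hence
  the conditional hypothesis on \<open>g\<close>.\<close>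

lemma interpol_mem_subspace:
  fixes g y :: "'b \<Rightarrow> 'a::{field,finite}"
  assumes "fun_space.subspace D" "i = 0 \<Longrightarrow> g \<in> D"
    and "(\<lambda>x. g x * y x ^ (CARD('a) - 1 - i)) \<in> D"
  shows "(\<lambda>x. g x * interpol i (y x)) \<in> D"
proof (cases "i = 0")
  case True
  then show ?thesis
    using fun_subspace_diff[OF assms(1) assms(2) assms(3)]
    by (simp add: interpol_def right_diff_distrib)
next
  case False
  then show ?thesis
    using fun_subspace_scale[OF assms(1,3), of "-1"] by (simp add: interpol_def)
qed

section \<open>Moments of functions with vanishing plane sums\<close>

lemma vec3_eq_iff: "x = y \<longleftrightarrow> x $ 1 = y $ 1 \<and> x $ 2 = y $ 2 \<and> x $ 3 = (y :: 'a ^ 3) $ 3"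
  by (simp add: vec_eq_iff forall_3)

lemma affine_plane_graph:
  "affine_plane {x :: 'a::field ^ 3. x $ 1 + s * x $ 2 + t * x $ 3 = c}"
proof -
  let ?b = "vector [-s, 1, 0] :: 'a ^ 3" and ?d = "vector [-t, 0, 1] :: 'a ^ 3"
  let ?V = "vec.span {?b, ?d}"
  have V: "x \<in> ?V \<longleftrightarrow> x $ 1 + s * x $ 2 + t * x $ 3 = 0" for x
  proof
    assume "x \<in> ?V"
    then show "x $ 1 + s * x $ 2 + t * x $ 3 = 0"
      by (auto simp: vec.span_insert vec.span_empty vec3_eq_iff algebra_simps)
  next
    assume "x $ 1 + s * x $ 2 + t * x $ 3 = 0"
    then have "x = x $ 2 *s ?b + x $ 3 *s ?d"
      by (auto simp: vec3_eq_iff algebra_simps eq_neg_iff_add_eq_0)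
    moreover have "x $ 2 *s ?b + x $ 3 *s ?d \<in> ?V"
      by (intro vec.span_add vec.span_scale vec.span_base) auto
    ultimately show "x \<in> ?V" by simp
  qed
  have ne: "?b \<noteq> ?d" by (simp add: vec3_eq_iff)
  have "vec.independent {?b, ?d}"
    by (auto simp: vec.independent_insert vec.span_insert vec.span_empty vec3_eq_iff)
  then have "vec.dim ?V = 2"
    using ne by (simp add: vec.dim_eq_card_independent)
  moreover have "{x. x $ 1 + s * x $ 2 + t * x $ 3 = c} = (\<lambda>v. vector [c, 0, 0] + v) ` ?V"
  proof (intro set_eqI iffI)
    fix x :: "'a ^ 3" assume "x \<in> {x. x $ 1 + s * x $ 2 + t * x $ 3 = c}"
    then have "x - vector [c, 0, 0] \<in> ?V" by (simp add: V algebra_simps)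
    then show "x \<in> (\<lambda>v. vector [c, 0, 0] + v) ` ?V"
      by (rule rev_image_eqI) simp
  qed (auto simp: V algebra_simps)
  ultimately show ?thesis
    unfolding affine_plane_def affine_subspace_dim_def using vec.subspace_span by blast
qed

lemma moment_eq_0:
  fixes f :: "'a::{field,finite} ^ 3 \<Rightarrow> 'a"
  assumes p: "prime CARD('a)" and f: "p_divisible f" and deg: "a + b + c < CARD('a)"
  shows "(\<Sum>x\<in>UNIV. f x * (x $ 1 ^ a * x $ 2 ^ b * x $ 3 ^ c)) = 0"
proof -
  define D where "D = {g :: 'a ^ 3 \<Rightarrow> 'a. (\<Sum>x\<in>UNIV. f x * g x) = 0}"
  have D: "fun_space.subspace D"
    by (rule fun_space.subspaceI)
       (auto simp: D_def fun_scale_def algebra_simps sum.distrib simp flip: sum_distrib_left)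
  have "(\<lambda>x. 1 * (x $ 1 + t * x $ 3 + s * x $ 2) ^ (a + b + c)) \<in> D" for s t
  proof -
    let ?l = "\<lambda>x :: 'a ^ 3. x $ 1 + t * x $ 3 + s * x $ 2"
    \<comment> \<open>Group the points by the value of \<open>?l\<close>: each fibre is a plane, and
      the power is constant on it.\<close>
    have "(\<Sum>x\<in>UNIV. f x * ?l x ^ (a + b + c))
        = (\<Sum>y\<in>UNIV. \<Sum>x | x \<in> UNIV \<and> ?l x = y. f x * ?l x ^ (a + b + c))"
      by (rule sum.group[symmetric]) auto
    also have "\<dots> = (\<Sum>y\<in>UNIV. (\<Sum>x | x $ 1 + s * x $ 2 + t * x $ 3 = y. f x) * y ^ (a + b + c))"
      by (simp add: sum_distrib_right add_ac)
    also have "\<dots> = 0"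
      by (simp add: f[unfolded p_divisible_def, rule_format, OF affine_plane_graph])
    finally show ?thesis by (simp add: D_def)
  qed
  \<comment> \<open>Isolate the power of \<open>x $ 2\<close> through \<open>s\<close>, then that of
    \<open>x $ 3\<close> through \<open>t\<close>.\<close>
  from binomial_term_mem_subspace[OF p D this deg, of b]
  have "(\<lambda>x. x $ 2 ^ b * (x $ 1 + t * x $ 3) ^ (a + c)) \<in> D" for t
    by (simp add: mult.commute)
  from binomial_term_mem_subspace[OF p D this, of c] deg
  have "(\<lambda>x. x $ 2 ^ b * (x $ 1 ^ a * x $ 3 ^ c)) \<in> D" by simp
  then show ?thesis by (simp add: D_def mult_ac)
qed

lemma mem_subspace_of_monomials:
  fixes f :: "'a::{field,finite} ^ 3 \<Rightarrow> 'a"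
  assumes p: "prime CARD('a)" and f: "p_divisible f" and D: "fun_space.subspace D"
    and mem: "\<And>i j k. i < CARD('a) \<Longrightarrow> j < CARD('a) \<Longrightarrow> k < CARD('a) \<Longrightarrow>
        i + j + k < 2 * (CARD('a) - 1) \<Longrightarrow> (\<lambda>x. x $ 1 ^ i * x $ 2 ^ j * x $ 3 ^ k) \<in> D"
  shows "f \<in> D"
proof -
  let ?p = "CARD('a)"
  \<comment> \<open>These are the coefficients of the reduced polynomial that represents
    \<open>f\<close>.\<close>
  define c where "c i j k = (\<Sum>y\<in>UNIV.
    f y * (interpol i (y $ 1) * interpol j (y $ 2) * interpol k (y $ 3)))" for i j k
  \<comment> \<open>The product of the three \<open>interpol\<close> factors has degree at most
    \<open>3 * (?p - 1) - (i + j + k)\<close>, which is at most \<open>?p - 1\<close>, so only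
    vanishing moments enter.\<close>
  have c0: "c i j k = 0" if "i + j + k \<ge> 2 * (?p - 1)" "i < ?p" "j < ?p" "k < ?p" for i j k
  proof -
    define E where "E = {g :: 'a ^ 3 \<Rightarrow> 'a. (\<Sum>x\<in>UNIV. f x * g x) = 0}"
    have E: "fun_space.subspace E"
      by (rule fun_space.subspaceI)
         (auto simp: E_def fun_scale_def algebra_simps sum.distrib simp flip: sum_distrib_left)
    have mon: "(\<lambda>x. x $ 1 ^ a * x $ 2 ^ b * x $ 3 ^ d) \<in> E" if "a + b + d < ?p" for a b d
      using moment_eq_0[OF p f that] by (simp add: E_def)
    \<comment> \<open>The monomial factors are replaced by \<open>interpol\<close> factors one
      coordinate at a time.\<close>
    have m1: "(\<lambda>x. x $ 2 ^ b * x $ 3 ^ d * interpol i (x $ 1)) \<in> E"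
      if "?p - 1 - i + b + d < ?p" for b d
      by (rule interpol_mem_subspace[OF E])
         (use mon[of 0 b d] mon[OF that] that in \<open>simp_all add: mult_ac\<close>)
    have m2: "(\<lambda>x. x $ 3 ^ d * interpol i (x $ 1) * interpol j (x $ 2)) \<in> E"
      if "?p - 1 - i + (?p - 1 - j) + d < ?p" for d
      by (rule interpol_mem_subspace[OF E])
         (use m1[of 0 d] m1[OF that] that in \<open>simp_all add: mult_ac\<close>)
    have le: "?p - 1 - i + (?p - 1 - j) + (?p - 1 - k) < ?p" using that by linarith
    have "(\<lambda>x. interpol i (x $ 1) * interpol j (x $ 2) * interpol k (x $ 3)) \<in> E"
      by (rule interpol_mem_subspace[OF E])
         (use m2[of 0] m2[OF le] le in \<open>simp_all add: mult_ac\<close>)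
    then show ?thesis by (simp add: E_def c_def)
  qed
  \<comment> \<open>Summed over \<open>i\<close>, \<open>j\<close>, \<open>k\<close>, the
    coordinatewise interpolations multiply to the indicator of \<open>x = y\<close>.\<close>
  have "f x = (\<Sum>i<?p. \<Sum>j<?p. \<Sum>k<?p. c i j k * (x $ 1 ^ i * x $ 2 ^ j * x $ 3 ^ k))" for x
  proof -
    have "(\<Sum>i<?p. \<Sum>j<?p. \<Sum>k<?p. c i j k * (x $ 1 ^ i * x $ 2 ^ j * x $ 3 ^ k))
      = (\<Sum>i<?p. \<Sum>j<?p. \<Sum>k<?p. \<Sum>y\<in>UNIV. f y * ((x $ 3 ^ k * interpol k (y $ 3)) *
          (x $ 2 ^ j * interpol j (y $ 2)) * (x $ 1 ^ i * interpol i (y $ 1))))"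
      unfolding c_def sum_distrib_right by (intro sum.cong refl) (simp only: mult_ac)
    also have "\<dots> = (\<Sum>y\<in>UNIV. \<Sum>i<?p. \<Sum>j<?p. \<Sum>k<?p. f y * ((x $ 3 ^ k * interpol k (y $ 3)) *
          (x $ 2 ^ j * interpol j (y $ 2)) * (x $ 1 ^ i * interpol i (y $ 1))))"
      by (simp only: sum.swap[where B = "UNIV :: ('a ^ 3) set"])
    also have "\<dots> = (\<Sum>y\<in>UNIV. f y * ((\<Sum>k<?p. x $ 3 ^ k * interpol k (y $ 3)) *
          (\<Sum>j<?p. x $ 2 ^ j * interpol j (y $ 2)) * (\<Sum>i<?p. x $ 1 ^ i * interpol i (y $ 1))))"
      by (simp only: sum_distrib_left sum_distrib_right)
    also have "\<dots> = (\<Sum>y\<in>UNIV. if y = x then f y else 0)"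
      by (intro sum.cong) (auto simp: sum_interpol vec3_eq_iff)
    finally show ?thesis by simp
  qed
  then have "f = (\<lambda>x. \<Sum>i<?p. \<Sum>j<?p. \<Sum>k<?p. c i j k * (x $ 1 ^ i * x $ 2 ^ j * x $ 3 ^ k))"
    by blast
  moreover have "(\<lambda>x. c i j k * (x $ 1 ^ i * x $ 2 ^ j * x $ 3 ^ k)) \<in> D"
    if "i < ?p" "j < ?p" "k < ?p" for i j k
  proof (cases "i + j + k < 2 * (?p - 1)")
    case True
    then show ?thesis using fun_subspace_scale[OF D mem] that by blast
  next
    case False
    then show ?thesis
      using c0[of i j k] that fun_space.subspace_0[OF D] by (simp add: zero_fun_def)
  qed
  ultimately show ?thesis
    by (auto intro!: fun_subspace_sum[OF D])
qed

section \<open>Differences of parallel lines\<close>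

lemma affine_line_coordinates:
  fixes s t c d :: "'a::field"
  shows "affine_line {x :: 'a ^ 3. x $ 1 + s * x $ 3 = c \<and> x $ 2 + t * x $ 3 = d}"
    (is "affine_line ?l")
    and "{x :: 'a ^ 3. x $ 1 + s * x $ 3 = c \<and> x $ 2 + t * x $ 3 = d}
      = (\<lambda>x. vector [c, d, 0] + x) ` {x. x $ 1 + s * x $ 3 = 0 \<and> x $ 2 + t * x $ 3 = 0}"
    (is "_ = _ ` ?V")
proof -
  \<comment> \<open>The solution of the homogeneous equations with third coordinate 1.\<close>
  let ?b = "vector [-s, -t, 1] :: 'a ^ 3"
  show l: "?l = (\<lambda>x. vector [c, d, 0] + x) ` ?V"
  proof (intro set_eqI iffI)
    fix x assume "x \<in> ?l"
    then have "x - vector [c, d, 0] \<in> ?V" by (auto simp: algebra_simps)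
    then show "x \<in> (\<lambda>x. vector [c, d, 0] + x) ` ?V" by (rule rev_image_eqI) simp
  qed (auto simp: add.assoc)
  have "?V = vec.span {?b}"
  proof (intro set_eqI iffI)
    fix x assume "x \<in> ?V"
    then have "x = x $ 3 *s ?b"
      by (auto simp: vec3_eq_iff algebra_simps eq_neg_iff_add_eq_0)
    then show "x \<in> vec.span {?b}"
      by (metis vec.span_scale vec.span_base singletonI)
  qed (auto simp: vec.span_singleton)
  moreover have "vec.independent {?b}"
    by (auto simp: vec.independent_insert vec.span_empty vec3_eq_iff)
  then have "vec.dim (vec.span {?b}) = 1"
    by (simp add: vec.dim_eq_card_independent)
  ultimately show "affine_line ?l"
    unfolding affine_line_def affine_subspace_dim_def l using vec.subspace_span by metis
qed

abbreviation line_differences :: "('a::{field,finite} ^ 3 \<Rightarrow> 'a) set" where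
  "line_differences \<equiv> {(\<lambda>x. indicator l1 x - indicator l2 x) | l1 l2. parallel_lines l1 l2}"

lemma parallel_lines_sym: "parallel_lines l m \<Longrightarrow> parallel_lines m l"
  unfolding parallel_lines_def
proof (elim conjE exE)
  fix a assume "m = (+) a ` l" "affine_line l" "affine_line m"
  then have "l = (+) (-a) ` m" by (auto simp: image_image)
  then show "affine_line m \<and> affine_line l \<and> (\<exists>a. l = (+) a ` m)"
    using \<open>affine_line l\<close> \<open>affine_line m\<close> by blast
qed

text \<open>The lines \<open>l c d\<close> partition the space. As the values of \<open>g\<close>
  sum to 0, the fixed line \<open>l 0 0\<close> can be subtracted from each of them without changing
  the combination.\<close>

lemma constant_on_lines_mem_span:
  fixes g :: "'a::{field,finite} \<Rightarrow> 'a \<Rightarrow> 'a"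
  assumes "(\<Sum>c\<in>UNIV. \<Sum>d\<in>UNIV. g c d) = 0"
  shows "(\<lambda>x :: 'a ^ 3. g (x $ 1 + s * x $ 3) (x $ 2 + t * x $ 3)) \<in> fun_space.span line_differences"
proof -
  let ?S = "fun_space.span line_differences :: ('a ^ 3 \<Rightarrow> 'a) set"
  define l where "l c d = {x :: 'a ^ 3. x $ 1 + s * x $ 3 = c \<and> x $ 2 + t * x $ 3 = d}" for c d
  have par: "parallel_lines (l c d) (l 0 0)" for c d
    unfolding l_def
    by (rule parallel_lines_sym, unfold parallel_lines_def, intro conjI exI)
       (rule affine_line_coordinates)+
  have "g (x $ 1 + s * x $ 3) (x $ 2 + t * x $ 3)
      = (\<Sum>c\<in>UNIV. \<Sum>d\<in>UNIV. g c d * (indicator (l c d) x - indicator (l 0 0) x))" for x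
  proof -
    have "(\<Sum>c\<in>UNIV. \<Sum>d\<in>UNIV. g c d * (indicator (l c d) x - indicator (l 0 0) x))
      = (\<Sum>c\<in>UNIV. \<Sum>d\<in>UNIV. g c d * indicator (l c d) x)
        - (\<Sum>c\<in>UNIV. \<Sum>d\<in>UNIV. g c d) * indicator (l 0 0) x"
      by (simp add: right_diff_distrib sum_subtractf sum_distrib_right)
    also have "\<dots> = (\<Sum>c\<in>UNIV. \<Sum>d\<in>UNIV. g c d * indicator (l c d) x)"
      using assms by simp
    also have "\<dots> = (\<Sum>c\<in>UNIV. if c = x $ 1 + s * x $ 3 then
        \<Sum>d\<in>UNIV. (if d = x $ 2 + t * x $ 3 then g c d else 0) else 0)"
      by (intro sum.cong refl) (auto simp: l_def indicator_def intro!: sum.cong sum.neutral)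
    finally show ?thesis by simp
  qed
  then have "(\<lambda>x. g (x $ 1 + s * x $ 3) (x $ 2 + t * x $ 3))
      = (\<lambda>x. \<Sum>c\<in>UNIV. \<Sum>d\<in>UNIV. g c d * (indicator (l c d) x - indicator (l 0 0) x))"
    by blast
  moreover have "(\<lambda>x. indicator (l c d) x - indicator (l 0 0) x) \<in> ?S" for c d
    using par by (intro fun_space.span_base) blast
  then have "(\<lambda>x. \<Sum>c\<in>UNIV. \<Sum>d\<in>UNIV. g c d * (indicator (l c d) x - indicator (l 0 0) x)) \<in> ?S"
    by (intro fun_subspace_sum fun_subspace_scale fun_space.subspace_span)
  ultimately show ?thesis by metis
qed

lemma monomial_mem_span:
  assumes p: "prime CARD('a::{field,finite})"
    and "i < CARD('a)" "j < CARD('a)" "k < CARD('a)" and deg: "i + j + k < 2 * (CARD('a) - 1)"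
  shows "(\<lambda>x :: 'a ^ 3. x $ 1 ^ i * x $ 2 ^ j * x $ 3 ^ k) \<in> fun_space.span line_differences"
proof -
  let ?D = "fun_space.span line_differences :: ('a ^ 3 \<Rightarrow> 'a) set"
  have D: "fun_space.subspace ?D" by (rule fun_space.subspace_span)
  txt \<open>The exponent of \<open>x\<^sub>3\<close> is split so that it can be absorbed into the other two without
    either of them exceeding \<open>p - 1\<close>.\<close>
  define r where "r = min k (CARD('a) - 1 - i)"
  define r' where "r' = k - r"
  have k: "k = r + r'" by (simp add: r_def r'_def)
  have a: "i + r < CARD('a)" using assms by (simp add: r_def)
  \<comment> \<open>If \<open>r' > 0\<close>, then \<open>i + r\<close> is already
    \<open>CARD('a) - 1\<close>, and \<open>deg\<close> bounds what is left.\<close>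
  have b: "j + r' < CARD('a)" using assms by (auto simp: r_def r'_def min_def)
  have "(\<Sum>c\<in>UNIV. \<Sum>d\<in>UNIV. c ^ (i + r) * d ^ (j + r') :: 'a)
      = (\<Sum>c\<in>UNIV. c ^ (i + r)) * (\<Sum>d\<in>UNIV. d ^ (j + r'))"
    by (simp add: sum_product)
  \<comment> \<open>The two exponents add up to \<open>i + j + k\<close>, so they cannot both reach
    \<open>CARD('a) - 1\<close>; the smaller one has power sum 0.\<close>
  moreover have "i + r < CARD('a) - 1 \<or> j + r' < CARD('a) - 1" using deg k by linarith
  ultimately have "(\<Sum>c\<in>UNIV. \<Sum>d\<in>UNIV. c ^ (i + r) * d ^ (j + r') :: 'a) = 0"
    using sum_power_eq_0[where 'a='a] by fastforce
  from constant_on_lines_mem_span[OF this]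
  have "(\<lambda>x. (x $ 2 + t * x $ 3) ^ (j + r') * (x $ 1 + s * x $ 3) ^ (i + r)) \<in> ?D" for s t
    by (simp add: mult.commute)
  from binomial_term_mem_subspace[OF p D this a, of r]
  have "(\<lambda>x. x $ 1 ^ i * x $ 3 ^ r * (x $ 2 + t * x $ 3) ^ (j + r')) \<in> ?D" for t
    by (simp add: mult_ac)
  from binomial_term_mem_subspace[OF p D this b, of r'] show ?thesis
    by (simp add: k power_add mult_ac)
qed

section \<open>Cylinders\<close>

lemma line_difference_cylinder_type:
  assumes "parallel_lines l1 (l2 :: ('a::{field,finite} ^ 3) set)"
  shows "cylinder_type_multiset (\<lambda>x. indicator l1 x - indicator l2 x :: 'a)"
proof -
  \<comment> \<open>The line \<open>l2\<close> is repeated \<open>CARD('a) - 1\<close> times, which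
    gives it weight -1.\<close>
  let ?l = "\<lambda>i :: nat. if i = 0 then l1 else l2"
  have refl: "parallel_lines l l" if "affine_line l" for l :: "('a ^ 3) set"
    using that unfolding parallel_lines_def by (auto intro!: exI[of _ 0])
  have aff: "affine_line l1" "affine_line l2"
    using assms by (auto simp: parallel_lines_def)
  have "(\<Sum>i<CARD('a). indicator (?l i) x) = (indicator l1 x - indicator l2 x :: 'a)" for x
  proof -
    obtain n where n: "CARD('a) = Suc n"
      using finite_UNIV_card_ge_0[where 'a='a] by (auto simp: gr0_conv_Suc)
    have "1 + of_nat n = (0 :: 'a)" using of_nat_CARD_eq_0[where 'a='a] by (simp add: n)
    then have "of_nat n = (-1 :: 'a)" by (metis add_eq_0_iff)
    then show ?thesis by (simp add: n sum.lessThan_Suc_shift del: sum.lessThan_Suc)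
  qed
  then show ?thesis
    unfolding cylinder_type_multiset_def
    using aff refl assms parallel_lines_sym[OF assms]
    by (intro exI[of _ ?l]) (auto simp: fun_eq_iff)
qed

text \<open>The translates cover all \<open>CARD('a) ^ 3\<close> points, and each has at most
  \<open>CARD('a)\<close> of them.\<close>

lemma card_le_translates_of_line:
  fixes l :: "('a::{field,finite} ^ 3) set"
  assumes "affine_line l"
  shows "CARD('a)\<^sup>2 \<le> card (range (\<lambda>a. (\<lambda>x. a + x) ` l))"
proof -
  let ?p = "CARD('a)"
  let ?Q = "range (\<lambda>a. (\<lambda>x. a + x) ` l)"
  obtain a V where V: "vec.subspace V" "vec.dim V = 1" and l: "l = (\<lambda>v. a + v) ` V"
    using assms by (auto simp: affine_line_def affine_subspace_dim_def)
  obtain B where B: "B \<subseteq> V" "V \<subseteq> vec.span B" "card B = vec.dim V"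
    using vec.basis_exists[of V] by metis
  then obtain w where "B = {w}" using V(2) by (metis card_1_singletonE)
  then have "V \<subseteq> range (\<lambda>c. c *s w)" using B(2) by (auto simp: vec.span_singleton)
  then have "card V \<le> ?p"
    by (metis card_image_le card_mono finite finite_imageI order.trans)
  then have cl: "card l \<le> ?p" unfolding l using card_image_le[of V] order.trans by (metis finite)
  have "0 \<in> V" using V(1) by (rule vec.subspace_0)
  then have "a \<in> l" unfolding l by force
  have "x \<in> \<Union>?Q" for x
    using \<open>a \<in> l\<close> by (auto intro!: exI[of _ "x - a"] rev_image_eqI)
  then have "(\<Union>?Q) = UNIV" by blast
  then have "?p ^ 3 = card (\<Union>?Q)" by (simp add: CARD_vec)
  also have "\<dots> \<le> (\<Sum>m\<in>?Q. card m)"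
    using card_UN_le[of ?Q "\<lambda>m. m"] by simp
  also have "\<dots> \<le> (\<Sum>m\<in>?Q. ?p)"
  proof (rule sum_mono)
    fix m assume "m \<in> ?Q"
    then obtain b where "m = (\<lambda>x. b + x) ` l" by blast
    then have "card m \<le> card l" by (simp add: card_image_le)
    then show "card m \<le> ?p" using cl by linarith
  qed
  finally have "?p * ?p\<^sup>2 \<le> ?p * card ?Q" by (simp add: power2_eq_square power3_eq_cube mult_ac)
  then show ?thesis by (simp add: finite_UNIV_card_ge_0)
qed

lemma affine_line_translate:
  assumes "affine_line l" shows "affine_line ((\<lambda>x. b + x) ` l)"
  using assms unfolding affine_line_def affine_subspace_dim_def
  by (metis (no_types, lifting) add.assoc image_cong image_image)

text \<open>Translates of a line are cosets of one direction space.\<close>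

lemma translates_disjoint:
  assumes "affine_line l" "(\<lambda>x. a + x) ` l \<inter> (\<lambda>x. b + x) ` l \<noteq> {}"
  shows "(\<lambda>x. a + x) ` l = (\<lambda>x. b + x) ` l"
proof -
  obtain c V where V: "vec.subspace V" and l: "l = (\<lambda>v. c + v) ` V"
    using assms by (auto simp: affine_line_def affine_subspace_dim_def)
  obtain u v where uv: "u \<in> V" "v \<in> V" "a + (c + u) = b + (c + v)"
    using assms(2) unfolding l by auto
  have sub: "(\<lambda>x. a' + x) ` l \<subseteq> (\<lambda>x. b' + x) ` l"
    if "u \<in> V" "v \<in> V" "a' + (c + u) = b' + (c + v)" for a' b' u v
  proof
    fix x assume "x \<in> (\<lambda>x. a' + x) ` l"
    then obtain w where w: "w \<in> V" "x = a' + (c + w)" unfolding l by auto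
    have "v - u + w \<in> V" using that w V by (simp add: vec.subspace_add vec.subspace_diff)
    moreover have "x = b' + (c + (v - u + w))"
      using that(3) w(2) by (simp add: algebra_simps eq_diff_eq)
    ultimately show "x \<in> (\<lambda>x. b' + x) ` l" unfolding l by blast
  qed
  show ?thesis using sub uv by (metis subset_antisym)
qed

text \<open>Both lines are completed to cylinders by the same \<open>p - 1\<close> parallel lines.\<close>

lemma line_difference_mem_span_cylinders:
  fixes l1 l2 :: "('a::{field,finite} ^ 3) set"
  assumes par: "parallel_lines l1 l2"
  shows "(\<lambda>x. indicator l1 x - indicator l2 x :: 'a) \<in> fun_space.span {indicator X | X. cylinder X}"
proof -
  let ?p = "CARD('a)"
  define Q where "Q = range (\<lambda>a. (\<lambda>x. a + x) ` l1)"
  have aff: "affine_line l1" using par by (simp add: parallel_lines_def)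
  have p: "?p \<ge> 2"
    using card_mono[of "UNIV :: 'a set" "{0, 1}"] by simp
  \<comment> \<open>There are at least \<open>?p\<^sup>2 \<ge> 2 * ?p\<close> translates, so enough
    remain after removing two.\<close>
  have "?p - 1 \<le> card (Q - {l1, l2})"
  proof -
    have "2 * ?p \<le> ?p\<^sup>2" using p by (simp add: power2_eq_square)
    also have "\<dots> \<le> card Q" unfolding Q_def by (rule card_le_translates_of_line[OF aff])
    finally have "2 * ?p \<le> card Q" .
    moreover have "card Q - card {l1, l2} \<le> card (Q - {l1, l2})"
      by (rule diff_card_le_card_Diff) simp
    moreover have "card {l1, l2} \<le> 2" by (simp add: card_insert_if)
    ultimately show ?thesis using p by linarith
  qed
  then obtain T where T: "T \<subseteq> Q - {l1, l2}" "card T = ?p - 1" "finite T"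
    by (rule obtain_subset_with_card_n)
  have disj: "m \<inter> m' = {}" if "m \<in> Q" "m' \<in> Q" "m \<noteq> m'" for m m'
    using that translates_disjoint[OF aff] unfolding Q_def by blast
  have parQ: "parallel_lines m m'" if m: "m \<in> Q" "m' \<in> Q" for m m'
  proof -
    obtain a b where ab: "m = (\<lambda>x. a + x) ` l1" "m' = (\<lambda>x. b + x) ` l1"
      using m by (auto simp: Q_def)
    then have "m' = (\<lambda>x. (b - a) + x) ` m" by (simp add: image_image)
    moreover have "affine_line m" "affine_line m'"
      using ab affine_line_translate[OF aff] by simp_all
    ultimately show ?thesis unfolding parallel_lines_def by blast
  qed
  have cyl: "(\<lambda>x. indicator (\<Union>T) x + indicator m x :: 'a) \<in> fun_space.span {indicator X | X. cylinder X}"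
    if m: "m \<in> Q" "m \<in> {l1, l2}" for m
  proof -
    have "m \<notin> T" using m T by blast
    have sub: "insert m T \<subseteq> Q" using m T by blast
    then have "cylinder (\<Union>(insert m T))"
      unfolding cylinder_def
      using T(2,3) \<open>m \<notin> T\<close> p parQ disj
      by (intro exI[of _ "insert m T"]) (auto simp: parallel_lines_def subset_eq)
    moreover have "m \<inter> \<Union>T = {}" using sub disj \<open>m \<notin> T\<close> by blast
    then have "(indicator (\<Union>(insert m T)) :: _ \<Rightarrow> 'a) = (\<lambda>x. indicator (\<Union>T) x + indicator m x)"
      by (auto simp: fun_eq_iff indicator_def)
    ultimately show ?thesis by (metis (mono_tags, lifting) fun_space.span_base mem_Collect_eq)
  qed
  have "l1 \<in> Q" unfolding Q_def by (rule range_eqI[of _ _ 0]) simp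
  moreover have "l2 \<in> Q" unfolding Q_def using par by (auto simp: parallel_lines_def)
  \<comment> \<open>The indicator of the shared lines \<open>T\<close> cancels in the difference of
    the two cylinders.\<close>
  ultimately show ?thesis
    using fun_subspace_diff[OF fun_space.subspace_span cyl[of l1] cyl[of l2]] by simp
qed

theorem theorem1p11:
  fixes p :: nat and f :: "'a::{field,finite} ^ 3 \<Rightarrow> 'a"
  assumes "prime p" and "CARD('a) = p"
    and "p_divisible f"
  shows "f \<in> fun_space.span {indicator X | X. cylinder X}
       \<and> f \<in> fun_space.span {g. cylinder_type_multiset g}
       \<and> f \<in> fun_space.span {(\<lambda>x. indicator l1 x - indicator l2 x) | l1 l2. parallel_lines l1 l2}"
proof -
  have p: "prime CARD('a)" using assms by simp
  have f: "f \<in> fun_space.span line_differences"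
    by (rule mem_subspace_of_monomials[OF p assms(3) fun_space.subspace_span])
       (rule monomial_mem_span[OF p])
  have "fun_space.span line_differences
      \<subseteq> (fun_space.span {indicator X | X. cylinder X} :: ('a ^ 3 \<Rightarrow> 'a) set)"
    by (rule fun_space.span_minimal[OF _ fun_space.subspace_span])
       (use line_difference_mem_span_cylinders in blast)
  moreover have "fun_space.span line_differences
      \<subseteq> (fun_space.span {g. cylinder_type_multiset g} :: ('a ^ 3 \<Rightarrow> 'a) set)"
    by (rule fun_space.span_mono) (use line_difference_cylinder_type in blast)
  ultimately show ?thesis using f by blast
qed

end
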